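(* Let $(\mathbf X,d)$ be a complete length space, $\Omega\subset\mathbf X$ an open set and $H:\Omega\times\mathbb R\times[0,\infty)\to\mathbb R$ a continuous function such that for every $R>0$, $\inf_{(x,\rho)\in\Omega\times[-R,R]}H(x,\rho,p)\to\infty$ as $p\to\infty$. Suppose that either (A) or (B) holds: (A) for any $x_0\in\Omega$ and $\rho_0\in\mathbb R$: there exist $\delta>0$ small and a modulus of continuity $\omega$ such that $|H(x_1,\rho_1,p)-H(x_2,\rho_2,p)|\le\omega(d(x_1,x_2)+|\rho_1-\rho_2|)$ for all $x_1,x_2\in B_\delta(x_0)$, $\rho_1,\rho_2\in[\rho_0-\delta,\rho_0+\delta]$, $p\ge0$; and there exist $\delta>0$ and $\lambda_0>0$ such that $p\mapsto H(x,\rho,p)-\lambda_0p$ is increasing (on $[0,\infty)$) for every $(x,\rho)\in B_\delta(x_0)\times[\rho_0-\delta,\rho_0+\delta]$; (B) $(\mathbf X,d)$ is a proper geodesic space, and for every $(x,\rho)\in\Omega\times\mathbb R$ the map $p\mapsto H(x,\rho,p)$ is strictly increasing in $(0,\infty)$. If $u$ is a Monge solution of $H(x,u,|\nabla u|)=0$ in $\Omega$, then $u$ is regular in $\Omega$, that is, $|\nabla u|(x)=|\nabla^-u|(x)$ for all $x\in\Omega$, and $u\in\underline{\mathcal C}(\Omega)$.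
   Context: $B_\delta(x)$ is the open $d$-ball. A modulus of continuity is a continuous nondecreasing function $\omega:[0,\infty)\to[0,\infty)$ with $\omega(0)=0$. Proper means that closed bounded subsets are compact. $\mathrm{Lip}_{loc}(\Omega)$ is the set of functions on $\Omega$ that are Lipschitz in a small ball around each point. Slopes: $|\nabla u|(x)=\limsup_{y\to x}\frac{|u(y)-u(x)|}{d(x,y)}$, $|\nabla^-u|(x)=\limsup_{y\to x}\frac{\max\{u(x)-u(y),0\}}{d(x,y)}$. Monge solution of $H(x,u,|\nabla u|)=0$: $u\in\mathrm{Lip}_{loc}(\Omega)$ with $H(x,u(x),|\nabla^-u|(x))=0$ for every $x\in\Omega$. $\underline{\mathcal C}(\Omega)$ is the set of $u\in\mathrm{Lip}_{loc}(\Omega)$ such that $|\nabla^-u|=|\nabla u|$ in $\Omega$ and $|\nabla u|$ is continuous in $\Omega$. *)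

theory Defs
  imports "HOL-Analysis.Analysis"
begin

section \<open>Length and geodesic spaces\<close>

definition curve_length :: "(real \<Rightarrow> 'a::metric_space) \<Rightarrow> ennreal" where
  "curve_length \<gamma> =
     (SUP (n, t) \<in> {(n, t). t 0 = (0::real) \<and> t n = 1 \<and> mono_on {..n} t}.
        \<Sum>i<n. ennreal (dist (\<gamma> (t i)) (\<gamma> (t (Suc i)))))"

text \<open>The infimum runs over all curves joining the two points. Non-rectifiable curves contribute
  \<open>\<infinity>\<close> and the infimum of the empty set is \<open>\<infinity>\<close>, so the equation forces rectifiable connections.\<close>

definition length_space :: "'a::metric_space itself \<Rightarrow> bool" where
  "length_space _ \<longleftrightarrow>
     (\<forall>x y :: 'a. ennreal (dist x y) =
        (INF \<gamma> \<in> {\<gamma>. path \<gamma> \<and> pathstart \<gamma> = x \<and> pathfinish \<gamma> = y}. curve_length \<gamma>))"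

definition geodesic_space :: "'a::metric_space itself \<Rightarrow> bool" where
  "geodesic_space _ \<longleftrightarrow>
     (\<forall>x y :: 'a. \<exists>\<gamma>. path \<gamma> \<and> pathstart \<gamma> = x \<and> pathfinish \<gamma> = y \<and>
        curve_length \<gamma> = ennreal (dist x y))"

definition proper_space :: "'a::metric_space itself \<Rightarrow> bool" where
  "proper_space _ \<longleftrightarrow> (\<forall>K :: 'a set. closed K \<and> bounded K \<longrightarrow> compact K)"

section \<open>Slopes and function classes\<close>

text \<open>Functions on an open set \<open>\<Omega>\<close> are represented by total functions. At points of \<open>\<Omega>\<close> the slopes
  depend only on the values in \<open>\<Omega>\<close>, because \<open>\<Omega>\<close> is open. The slopes take values in \<open>[0, \<infinity>]\<close>;
  they are finite for locally Lipschitz functions, and zero at isolated points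
  (which a length space has only if it is a single point).\<close>

definition slope :: "('a::metric_space \<Rightarrow> real) \<Rightarrow> 'a \<Rightarrow> ennreal" where
  "slope u x = Limsup (at x) (\<lambda>y. ennreal (\<bar>u y - u x\<bar> / dist x y))"

definition subslope :: "('a::metric_space \<Rightarrow> real) \<Rightarrow> 'a \<Rightarrow> ennreal" where
  "subslope u x = Limsup (at x) (\<lambda>y. ennreal (max (u x - u y) 0 / dist x y))"

definition Lip_loc :: "'a::metric_space set \<Rightarrow> ('a \<Rightarrow> real) set" where
  "Lip_loc \<Omega> = {u. \<forall>x\<in>\<Omega>. \<exists>r>0. ball x r \<subseteq> \<Omega> \<and> (\<exists>L. L-lipschitz_on (ball x r) u)}"

definition regular_on :: "'a::metric_space set \<Rightarrow> ('a \<Rightarrow> real) \<Rightarrow> bool" where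
  "regular_on \<Omega> u \<longleftrightarrow> (\<forall>x\<in>\<Omega>. slope u x = subslope u x)"

definition C_lower :: "'a::metric_space set \<Rightarrow> ('a \<Rightarrow> real) set" where
  "C_lower \<Omega> = {u \<in> Lip_loc \<Omega>. (\<forall>x\<in>\<Omega>. subslope u x = slope u x) \<and> continuous_on \<Omega> (slope u)}"

section \<open>Hamiltonians and Monge solutions\<close>

text \<open>A Hamiltonian \<open>H : \<Omega> \<times> \<real> \<times> [0, \<infinity>) \<rightarrow> \<real>\<close> is a total curried function that is only
  constrained, and only evaluated, on that domain. The conversion \<open>enn2real\<close> is harmless below,
  since the subslope of a locally Lipschitz function is finite.\<close>

definition monge_solution ::
  "'a::metric_space set \<Rightarrow> ('a \<Rightarrow> real \<Rightarrow> real \<Rightarrow> real) \<Rightarrow> ('a \<Rightarrow> real) \<Rightarrow> bool" where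
  "monge_solution \<Omega> H u \<longleftrightarrow>
     u \<in> Lip_loc \<Omega> \<and> (\<forall>x\<in>\<Omega>. H x (u x) (enn2real (subslope u x)) = 0)"

definition modulus_of_continuity :: "(real \<Rightarrow> real) \<Rightarrow> bool" where
  "modulus_of_continuity \<omega> \<longleftrightarrow>
     continuous_on {0..} \<omega> \<and> mono_on {0..} \<omega> \<and> (\<forall>s\<ge>0. 0 \<le> \<omega> s) \<and> \<omega> 0 = 0"

text \<open>The infimum is taken in the extended reals, since it may be \<open>-\<infinity>\<close> for small \<open>p\<close>.\<close>

definition coercive :: "'a::metric_space set \<Rightarrow> ('a \<Rightarrow> real \<Rightarrow> real \<Rightarrow> real) \<Rightarrow> bool" where
  "coercive \<Omega> H \<longleftrightarrow>
     (\<forall>R>0. ((\<lambda>p. INF (x, \<rho>) \<in> \<Omega> \<times> {-R..R}. ereal (H x \<rho> p)) \<longlongrightarrow> \<infinity>) at_top)"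

text \<open>The inclusion \<open>ball x\<^sub>0 \<delta> \<subseteq> \<Omega>\<close> keeps the arguments inside the domain of \<open>H\<close>.\<close>

definition locally_uniformly_continuous ::
  "'a::metric_space set \<Rightarrow> ('a \<Rightarrow> real \<Rightarrow> real \<Rightarrow> real) \<Rightarrow> bool" where
  "locally_uniformly_continuous \<Omega> H \<longleftrightarrow>
     (\<forall>x\<^sub>0\<in>\<Omega>. \<forall>\<rho>\<^sub>0. \<exists>\<delta>>0. \<exists>\<omega>. ball x\<^sub>0 \<delta> \<subseteq> \<Omega> \<and> modulus_of_continuity \<omega> \<and>
        (\<forall>x\<^sub>1\<in>ball x\<^sub>0 \<delta>. \<forall>x\<^sub>2\<in>ball x\<^sub>0 \<delta>.
           \<forall>\<rho>\<^sub>1\<in>{\<rho>\<^sub>0 - \<delta>..\<rho>\<^sub>0 + \<delta>}. \<forall>\<rho>\<^sub>2\<in>{\<rho>\<^sub>0 - \<delta>..\<rho>\<^sub>0 + \<delta>}. \<forall>p\<ge>0.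
             \<bar>H x\<^sub>1 \<rho>\<^sub>1 p - H x\<^sub>2 \<rho>\<^sub>2 p\<bar> \<le> \<omega> (dist x\<^sub>1 x\<^sub>2 + \<bar>\<rho>\<^sub>1 - \<rho>\<^sub>2\<bar>)))"

text \<open>Increasing is meant in the weak sense; strictness would not change the condition, since
  \<open>\<kappa>\<close> may be decreased.\<close>

definition locally_strongly_increasing ::
  "'a::metric_space set \<Rightarrow> ('a \<Rightarrow> real \<Rightarrow> real \<Rightarrow> real) \<Rightarrow> bool" where
  "locally_strongly_increasing \<Omega> H \<longleftrightarrow>
     (\<forall>x\<^sub>0\<in>\<Omega>. \<forall>\<rho>\<^sub>0. \<exists>\<delta>>0. \<exists>\<kappa>>0. ball x\<^sub>0 \<delta> \<subseteq> \<Omega> \<and>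
        (\<forall>x\<in>ball x\<^sub>0 \<delta>. \<forall>\<rho>\<in>{\<rho>\<^sub>0 - \<delta>..\<rho>\<^sub>0 + \<delta>}. mono_on {0..} (\<lambda>p. H x \<rho> p - \<kappa> * p)))"

end

theory Submission imports Defs begin

text \<open>Strict monotonicity of \<open>H\<close> in \<open>p\<close> makes the root \<open>p(x) = |\<nabla>\<^sup>-u|(x)\<close> of
  \<open>H(x, u(x), p) = 0\<close> a continuous function of \<open>x\<close>. If \<open>|\<nabla>\<^sup>-u| < K\<close> near \<open>x\<^sub>0\<close>, then along a curve the
  function \<open>u\<close> decreases at most by \<open>K\<close> times the length; applied to almost shortest curves in both
  directions, this makes \<open>u\<close> \<open>K\<close>-Lipschitz near \<open>x\<^sub>0\<close>. Letting \<open>K\<close> decrease to \<open>p(x\<^sub>0)\<close> gives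
  \<open>|\<nabla>u|(x\<^sub>0) \<le> |\<nabla>\<^sup>-u|(x\<^sub>0)\<close>.\<close>

section \<open>Arc length of curves\<close>

text \<open>This is the length of the restriction of \<gamma> to the interval from 0 to
  \<open>s\<close>. Letting the partitions end at \<open>s\<close> avoids any reparametrization to
  the unit interval.\<close>

definition initial_length :: "(real \<Rightarrow> 'a::metric_space) \<Rightarrow> real \<Rightarrow> ennreal" where
  "initial_length \<gamma> s =
     (SUP (n, t) \<in> {(n, t). t 0 = (0::real) \<and> t n = s \<and> mono_on {..n} t}.
        \<Sum>i<n. ennreal (dist (\<gamma> (t i)) (\<gamma> (t (Suc i)))))"

lemma initial_length_1: "initial_length \<gamma> 1 = curve_length \<gamma>"
  by (simp add: initial_length_def curve_length_def)

text \<open>Appending \<open>s'\<close> to a partition that ends at \<open>s\<close> gives a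
  partition that ends at \<open>s'\<close>, and its sum grows by exactly the distance of the two
  curve points.\<close>

lemma initial_length_add_dist_le:
  assumes "0 \<le> s" "s \<le> s'"
  shows "initial_length \<gamma> s + ennreal (dist (\<gamma> s) (\<gamma> s')) \<le> initial_length \<gamma> s'"
proof -
  let ?P = "\<lambda>s. {(n :: nat, t). t 0 = (0::real) \<and> t n = s \<and> mono_on {..n} t}"
  let ?f = "\<lambda>(n, t). \<Sum>i<n. ennreal (dist (\<gamma> (t i)) (\<gamma> (t (Suc i))))"
  have "(1, \<lambda>i. if i = 0 then 0 else s) \<in> ?P s"
    using assms(1) by (auto simp: mono_on_def)
  then have ne: "?P s \<noteq> {}" by blast
  have "initial_length \<gamma> s + ennreal (dist (\<gamma> s) (\<gamma> s')) =
      (SUP x \<in> ?P s. ?f x + ennreal (dist (\<gamma> s) (\<gamma> s')))"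
    unfolding initial_length_def by (rule ennreal_SUP_add_left[OF ne, symmetric])
  also have "\<dots> \<le> initial_length \<gamma> s'"
  proof (rule SUP_least)
    fix x assume "x \<in> ?P s"
    then obtain n t where x: "x = (n, t)" and t: "t 0 = 0" "s = t n" "mono_on {..n} t" by blast
    define t' where "t' = t(Suc n := s')"
    have "t i \<le> s'" if "i \<le> n" for i
      using monotone_onD[OF t(3), of i n] that assms(2) t(2) by auto
    then have P: "(Suc n, t') \<in> ?P s'"
      using t by (auto simp: t'_def mono_on_def le_Suc_eq)
    have "?f (n, t) + ennreal (dist (\<gamma> (t n)) (\<gamma> s')) = ?f (Suc n, t')"
      by (simp add: t'_def del: sum_ennreal)
    also have "\<dots> \<le> initial_length \<gamma> s'"
      unfolding initial_length_def by (rule SUP_upper[OF P])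
    finally show "?f x + ennreal (dist (\<gamma> s) (\<gamma> s')) \<le> initial_length \<gamma> s'"
      using x t(2) by simp
  qed
  finally show ?thesis .
qed

text \<open>A curve of finite length has a real-valued arc length \<open>L\<close>, so later
  estimates can subtract. The one inequality for \<open>L\<close> encodes both its monotonicity and
  its control of distances along the curve.\<close>

lemma rectifiable_length_function:
  assumes "curve_length \<gamma> < ennreal l"
  obtains L where "\<And>s t. 0 \<le> s \<Longrightarrow> s \<le> t \<Longrightarrow> t \<le> 1 \<Longrightarrow> L s + dist (\<gamma> s) (\<gamma> t) \<le> (L t :: real)"
    and "L 1 - L 0 < l"
proof
  have fin: "initial_length \<gamma> t < \<infinity>" if "0 \<le> t" "t \<le> 1" for t
  proof -
    have "initial_length \<gamma> t \<le> initial_length \<gamma> t + ennreal (dist (\<gamma> t) (\<gamma> 1))" by simp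
    also have "\<dots> \<le> curve_length \<gamma>"
      using initial_length_add_dist_le[OF that, of \<gamma>] by (simp add: initial_length_1)
    also have "\<dots> < \<infinity>" using assms by (simp add: less_trans)
    finally show ?thesis .
  qed
  show "enn2real (initial_length \<gamma> s) + dist (\<gamma> s) (\<gamma> t) \<le> enn2real (initial_length \<gamma> t)"
    if "0 \<le> s" "s \<le> t" "t \<le> 1" for s t
  proof -
    have "enn2real (initial_length \<gamma> s + ennreal (dist (\<gamma> s) (\<gamma> t))) \<le> enn2real (initial_length \<gamma> t)"
      using initial_length_add_dist_le[OF that(1,2)] fin[of t] that by (intro enn2real_mono) auto
    then show ?thesis using fin[of s] that by (simp add: enn2real_plus)
  qed
  have "enn2real (initial_length \<gamma> 1) < l"
    using assms fin[of 1]
    by (cases "curve_length \<gamma>") (auto simp: initial_length_1 ennreal_less_iff)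
  then show "enn2real (initial_length \<gamma> 1) - enn2real (initial_length \<gamma> 0) < l"
    using enn2real_nonneg[of "initial_length \<gamma> 0"] by linarith
qed

section \<open>Slopes and the decrease of a function along a curve\<close>

lemma subslope_le_slope: "subslope u x \<le> slope u x"
  unfolding subslope_def slope_def
  by (intro Limsup_mono always_eventually allI ennreal_leI divide_right_mono) auto

lemma slope_le_lipschitz:
  assumes "0 < r" "L-lipschitz_on (ball x r) u"
  shows "slope u x \<le> ennreal L"
  unfolding slope_def
proof (rule Limsup_bounded)
  have "\<bar>u y - u x\<bar> / dist x y \<le> L" if "y \<in> ball x r" "y \<noteq> x" for y
    using lipschitz_onD[OF assms(2) that(1), of x] assms(1) that(2)
    by (simp add: dist_real_def divide_le_eq dist_commute)
  then show "\<forall>\<^sub>F y in at x. ennreal (\<bar>u y - u x\<bar> / dist x y) \<le> ennreal L"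
    unfolding eventually_at using assms(1)
    by (intro exI[of _ r]) (auto simp: dist_commute intro!: ennreal_leI)
qed

text \<open>An upper limit strictly below \<open>K\<close> bounds the quotients near
  \<open>x\<close> by \<open>K\<close>. At \<open>y = x\<close> the inequality is trivial, so it
  holds along \<open>nhds x\<close>; this allows composition with a curve that lingers at
  \<open>x\<close> or returns to it.\<close>

lemma subslope_lessD:
  assumes "subslope u x < ennreal K"
  shows "\<forall>\<^sub>F y in nhds x. u x - K * dist x y \<le> u y"
proof -
  have "\<forall>\<^sub>F y in at x. ennreal (max (u x - u y) 0 / dist x y) < ennreal K"
    using assms unfolding subslope_def by (rule Limsup_lessD)
  then have "\<forall>\<^sub>F y in at x. u x - K * dist x y \<le> u y"
  proof (rule eventually_mono[OF eventually_conj[OF _ eventually_neq_at_within[of x]]], clarify)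
    fix y assume y: "ennreal (max (u x - u y) 0 / dist x y) < ennreal K" "y \<noteq> x"
    then have "max (u x - u y) 0 / dist x y < K"
      by (subst (asm) ennreal_less_iff) auto
    then show "u x - K * dist x y \<le> u y"
      using y(2) by (simp add: divide_less_eq)
  qed
  then show ?thesis
    by (simp add: eventually_nhds_conv_at)
qed

text \<open>Continuation argument: let \<open>S\<close> be the set of times at which the estimate
  holds. Its supremum \<open>m\<close> lies in \<open>S\<close>, and for \<open>m < 1\<close> the
  local bound at \<open>\<gamma> m\<close> would yield later times in \<open>S\<close>.\<close>

lemma subslope_less_along_curve:
  fixes L :: "real \<Rightarrow> real"
  assumes L: "\<And>s t. 0 \<le> s \<Longrightarrow> s \<le> t \<Longrightarrow> t \<le> 1 \<Longrightarrow> L s + dist (\<gamma> s) (\<gamma> t) \<le> L t"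
    and \<gamma>: "path \<gamma>" "path_image \<gamma> \<subseteq> B" and u: "continuous_on B u"
    and K: "0 \<le> K" "\<And>x. x \<in> B \<Longrightarrow> subslope u x < ennreal K"
  shows "u (\<gamma> 0) - K * (L 1 - L 0) \<le> u (\<gamma> 1)"
proof -
  define S where "S = {t \<in> {0..1}. u (\<gamma> 0) - K * (L t - L 0) \<le> u (\<gamma> t)}"
  define m where "m = Sup S"
  have S0: "0 \<in> S" by (simp add: S_def)
  have bdd: "bdd_above S" unfolding S_def by (auto intro: bdd_aboveI[of _ 1])
  have m_ub: "t \<le> m" if "t \<in> S" for t
    unfolding m_def using that bdd by (rule cSup_upper)
  have "m \<le> 1" unfolding m_def
    by (rule cSup_least) (use S0 in \<open>blast, simp add: S_def\<close>)
  then have m01: "m \<in> {0..1}" using m_ub[OF S0] by simp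
  have cont\<gamma>: "continuous_on {0..1} \<gamma>" using \<gamma>(1) by (simp add: path_def)
  have contu\<gamma>: "continuous_on {0..1} (\<lambda>t. u (\<gamma> t))"
    using continuous_on_compose2[OF u cont\<gamma>] \<gamma>(2) by (simp add: path_image_def)
  \<comment> \<open>\<open>L\<close> may jump, but it is monotone, so replacing \<open>L t\<close> by \<open>L m\<close> turns \<open>S\<close> into a subset of a
    closed set.\<close>
  have "m \<in> {t \<in> {0..1}. u (\<gamma> 0) - K * (L m - L 0) \<le> u (\<gamma> t)}" (is "m \<in> ?C")
  proof -
    have "closed ?C"
      using continuous_closed_preimage[OF contu\<gamma> closed_atLeastAtMost, of "{u (\<gamma> 0) - K * (L m - L 0)..}"]
      by (auto simp: vimage_def Int_def)
    moreover have "S \<subseteq> ?C"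
    proof
      fix t assume t: "t \<in> S"
      then have "L t + dist (\<gamma> t) (\<gamma> m) \<le> L m"
        using L[of t m] m01 m_ub[OF t] by (simp add: S_def)
      then have "L t \<le> L m" using zero_le_dist[of "\<gamma> t" "\<gamma> m"] by linarith
      then have "K * (L t - L 0) \<le> K * (L m - L 0)"
        using K(1) by (intro mult_left_mono) auto
      then show "t \<in> ?C" using t by (auto simp: S_def)
    qed
    ultimately show ?thesis
      unfolding m_def using closed_subset_contains_Sup[of ?C S] S0 bdd m_def by auto
  qed
  then have mS: "u (\<gamma> 0) - K * (L m - L 0) \<le> u (\<gamma> m)" by simp
  have "m = 1"
  proof (rule ccontr)
    assume "m \<noteq> 1"
    then have m1: "m < 1" using m01 by simp
    have "\<gamma> m \<in> B" using \<gamma>(2) m01 by (auto simp: path_image_def)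
    then have "\<forall>\<^sub>F y in nhds (\<gamma> m). u (\<gamma> m) - K * dist (\<gamma> m) y \<le> u y"
      using K(2) by (intro subslope_lessD)
    moreover have "(\<gamma> \<longlongrightarrow> \<gamma> m) (at_right m)"
      using continuous_on_subset[OF cont\<gamma>, of "{m..1}"] m01 m1
      by (auto intro: continuous_on_Icc_at_rightD)
    ultimately have "\<forall>\<^sub>F t in at_right m. u (\<gamma> m) - K * dist (\<gamma> m) (\<gamma> t) \<le> u (\<gamma> t)"
      by (rule eventually_compose_filterlim)
    then have "\<forall>\<^sub>F t in at_right m. m < t \<and> t < 1 \<and> u (\<gamma> m) - K * dist (\<gamma> m) (\<gamma> t) \<le> u (\<gamma> t)"
      using eventually_at_right_real[OF m1] by eventually_elim auto
    then obtain t where t: "m < t" "t < 1" "u (\<gamma> m) - K * dist (\<gamma> m) (\<gamma> t) \<le> u (\<gamma> t)"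
      using eventually_happens[of _ "at_right m"] by (auto simp: trivial_limit_at_right_real)
    \<comment> \<open>The local loss of \<open>u\<close> after time \<open>m\<close> is at most
      \<open>K\<close> times the distance, hence at most \<open>K * (L t - L m)\<close>; it adds up
      with the loss until \<open>m\<close>.\<close>
    have "K * (L m + dist (\<gamma> m) (\<gamma> t)) \<le> K * L t"
      using L[of m t] m01 t K(1) by (intro mult_left_mono) auto
    then have "t \<in> S" using t mS m01 by (auto simp: S_def algebra_simps)
    then show False using m_ub t(1) by fastforce
  qed
  then show ?thesis using mS by simp
qed

section \<open>Lipschitz estimates in length spaces\<close>

lemma length_space_short_curve:
  fixes x y :: "'a::metric_space"
  assumes "length_space TYPE('a)" "dist x y < l"
  obtains \<gamma> where "path \<gamma>" "\<gamma> 0 = x" "\<gamma> 1 = y" "curve_length \<gamma> < ennreal l"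
proof -
  have "ennreal (dist x y) < ennreal l" using assms(2) by (simp add: ennreal_less_iff)
  then have "(INF \<gamma> \<in> {\<gamma>. path \<gamma> \<and> pathstart \<gamma> = x \<and> pathfinish \<gamma> = y}. curve_length \<gamma>) < ennreal l"
    using assms(1) by (simp add: length_space_def)
  then show ?thesis
    using that by (auto simp: INF_less_iff pathstart_def pathfinish_def)
qed

text \<open>The curve estimate is one-sided, but it applies to the pair \<open>x\<close>,
  \<open>y\<close> in both orders, so a bound on decrease alone bounds the absolute difference. The
  radius \<open>r / 3\<close> keeps short connecting curves inside the larger ball: they start
  within \<open>r / 3\<close> of the center and are shorter than \<open>2 * r / 3\<close>.\<close>

lemma lipschitz_on_if_subslope_less:
  fixes u :: "'a::metric_space \<Rightarrow> real"
  assumes len: "length_space TYPE('a)" and u: "continuous_on (ball x\<^sub>0 r) u"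
    and K: "0 \<le> K" "\<And>x. x \<in> ball x\<^sub>0 r \<Longrightarrow> subslope u x < ennreal K"
  shows "K-lipschitz_on (ball x\<^sub>0 (r / 3)) u"
proof -
  have le: "u x - u y \<le> K * dist x y" if xy: "x \<in> ball x\<^sub>0 (r / 3)" "y \<in> ball x\<^sub>0 (r / 3)" for x y
  proof -
    have d: "dist x y < 2 * r / 3"
      using xy dist_triangle2[of x y x\<^sub>0] by (simp add: dist_commute)
    \<comment> \<open>A length space provides only curves slightly longer than the distance, so the
      bound is proved for every such \<open>l\<close>, and then \<open>l\<close> decreases to
      \<open>dist x y\<close>.\<close>
    have *: "u x - u y \<le> K * l" if l: "dist x y < l" "l < 2 * r / 3" for l
    proof -
      obtain \<gamma> where \<gamma>: "path \<gamma>" "\<gamma> 0 = x" "\<gamma> 1 = y" "curve_length \<gamma> < ennreal l"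
        using length_space_short_curve[OF len l(1)] .
      obtain L where L: "\<And>s t. 0 \<le> s \<Longrightarrow> s \<le> t \<Longrightarrow> t \<le> 1 \<Longrightarrow> L s + dist (\<gamma> s) (\<gamma> t) \<le> L t"
          and L1: "L 1 - L 0 < l"
        using rectifiable_length_function[OF \<gamma>(4)] by blast
      have "path_image \<gamma> \<subseteq> ball x\<^sub>0 r"
      proof
        fix z assume "z \<in> path_image \<gamma>"
        then obtain t where t: "0 \<le> t" "t \<le> 1" "z = \<gamma> t" by (auto simp: path_image_def)
        \<comment> \<open>The arc from \<open>x\<close> to \<open>z\<close> is no longer than the
          whole curve.\<close>
        have "dist x z < l"
          using L[of 0 t] L[of t 1] L1 t \<gamma>(2) zero_le_dist[of "\<gamma> t" "\<gamma> 1"] by (simp del: zero_le_dist)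
        then show "z \<in> ball x\<^sub>0 r"
          using xy(1) l(2) dist_triangle[of x\<^sub>0 z x] by simp
      qed
      then have "u x - K * (L 1 - L 0) \<le> u y"
        using subslope_less_along_curve[OF L \<gamma>(1) _ u K] \<gamma>(2,3) by simp
      moreover have "K * (L 1 - L 0) \<le> K * l"
        using L1 K(1) by (intro mult_left_mono) auto
      ultimately show ?thesis by linarith
    qed
    have "\<forall>\<^sub>F l in at_right (dist x y). u x - u y \<le> K * l"
      using eventually_at_right_real[OF d] by eventually_elim (auto intro: *)
    moreover have "((\<lambda>l. K * l) \<longlongrightarrow> K * dist x y) (at_right (dist x y))"
      by (intro tendsto_intros)
    ultimately show ?thesis
      by (intro tendsto_lowerbound) auto
  qed
  show ?thesis
  proof (rule lipschitz_onI)
    fix x y assume "x \<in> ball x\<^sub>0 (r / 3)" "y \<in> ball x\<^sub>0 (r / 3)"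
    then show "dist (u x) (u y) \<le> K * dist x y"
      using le[of x y] le[of y x] by (simp add: dist_real_def abs_le_iff dist_commute)
  qed (rule K(1))
qed

section \<open>Roots of strictly increasing functions\<close>

text \<open>Condition (B) speaks of positive \<open>p\<close> only, whereas the subslope may
  vanish.\<close>

lemma strict_mono_on_atLeast_if_greaterThan:
  fixes f :: "real \<Rightarrow> real"
  assumes "strict_mono_on {0<..} f" "continuous_on {0..} f"
  shows "strict_mono_on {0..} f"
proof (rule strict_mono_onI)
  fix p q :: real assume pq: "p \<in> {0..}" "q \<in> {0..}" "p < q"
  show "f p < f q"
  proof (cases "p = 0")
    case True
    \<comment> \<open>The limit at 0 preserves only weak inequalities; the intermediate point
      \<open>q / 2\<close> restores strictness.\<close>
    have "\<forall>\<^sub>F s in at_right 0. f s \<le> f (q / 2)"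
      using eventually_at_right_real[of 0 "q / 2"] pq True
      by (auto elim!: eventually_mono intro!: less_imp_le strict_mono_onD[OF assms(1)])
    moreover have "(f \<longlongrightarrow> f 0) (at_right 0)"
      using assms(2) by (auto simp: continuous_on_def intro: tendsto_within_subset)
    ultimately have "f 0 \<le> f (q / 2)" by (intro tendsto_upperbound) auto
    also have "\<dots> < f q" using pq True by (intro strict_mono_onD[OF assms(1)]) auto
    finally show ?thesis using True by simp
  next
    case False
    then show ?thesis using pq by (intro strict_mono_onD[OF assms(1)]) auto
  qed
qed

text \<open>By monotonicity the sign of \<open>F y a\<close> tells on which side of \<open>a\<close>
  the root \<open>p y\<close> lies. For fixed \<open>a\<close> different from \<open>p x\<close>
  this sign persists near \<open>x\<close>, so continuity in the first argument suffices.\<close>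

lemma continuous_on_root:
  fixes p :: "'a::topological_space \<Rightarrow> real"
  assumes cont: "\<And>q. 0 \<le> q \<Longrightarrow> continuous_on S (\<lambda>x. F x q :: real)"
    and mono: "\<And>x. x \<in> S \<Longrightarrow> strict_mono_on {0..} (F x)"
    and p: "\<And>x. x \<in> S \<Longrightarrow> 0 \<le> p x" "\<And>x. x \<in> S \<Longrightarrow> F x (p x) = 0"
  shows "continuous_on S p"
  unfolding continuous_on_def
proof (intro ballI order_tendstoI)
  fix x a assume x: "x \<in> S"
  have ev: "\<forall>\<^sub>F y in at x within S. y \<in> S" by (simp add: eventually_at_topological) blast
  have lim: "((\<lambda>y. F y a) \<longlongrightarrow> F x a) (at x within S)" if "0 \<le> a"
    using cont[OF that] x by (simp add: continuous_on_def)
  { assume a: "a < p x"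
    show "\<forall>\<^sub>F y in at x within S. a < p y"
    proof (cases "0 \<le> a")
      case True
      have "F x a < 0" using strict_mono_onD[OF mono[OF x], of a "p x"] True a p x by simp
      from order_tendstoD(2)[OF lim[OF True] this] ev show ?thesis
      proof eventually_elim
        case (elim y)
        then show ?case
          using strict_mono_on_leD[OF mono[OF elim(2)], of "p y" a] True p by fastforce
      qed
    next
      \<comment> \<open>A negative \<open>a\<close> lies outside the range of monotonicity, but
        below every root.\<close>
      case False
      from ev show ?thesis by eventually_elim (use p(1) False in force)
    qed }
  { assume a: "p x < a"
    then have a0: "0 \<le> a" using p(1)[OF x] by linarith
    have "0 < F x a" using strict_mono_onD[OF mono[OF x], of "p x" a] a0 a p x by simp
    from order_tendstoD(1)[OF lim[OF a0] this] ev show "\<forall>\<^sub>F y in at x within S. p y < a"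
    proof eventually_elim
      case (elim y)
      then show ?case
        using strict_mono_on_leD[OF mono[OF elim(2)], of a "p y"] a0 p by fastforce
    qed }
qed

section \<open>Regularity of Monge solutions\<close>

lemma Lip_loc_continuous_on:
  assumes "u \<in> Lip_loc \<Omega>"
  shows "continuous_on \<Omega> u"
proof (rule continuous_at_imp_continuous_on, rule ballI)
  fix x assume "x \<in> \<Omega>"
  then obtain r L where "r > 0" "L-lipschitz_on (ball x r) u" using assms by (auto simp: Lip_loc_def)
  then show "isCont u x"
    using lipschitz_on_continuous_on continuous_on_interior[of "ball x r"] by (metis centre_in_ball interior_ball)
qed

theorem proposition4p15:
  fixes \<Omega> :: "'a::complete_space set"
    and H :: "'a \<Rightarrow> real \<Rightarrow> real \<Rightarrow> real"
    and u :: "'a \<Rightarrow> real"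
  assumes "length_space TYPE('a)"
    and "open \<Omega>"
    and "continuous_on (\<Omega> \<times> UNIV \<times> {0..}) (\<lambda>(x, \<rho>, p). H x \<rho> p)"
    and "coercive \<Omega> H"
    and "(locally_uniformly_continuous \<Omega> H \<and> locally_strongly_increasing \<Omega> H)
       \<or> (proper_space TYPE('a) \<and> geodesic_space TYPE('a) \<and>
          (\<forall>x\<in>\<Omega>. \<forall>\<rho>. strict_mono_on {0<..} (\<lambda>p. H x \<rho> p)))"
    and "monge_solution \<Omega> H u"
  shows "regular_on \<Omega> u \<and> u \<in> C_lower \<Omega>"
proof -
  define p where "p x = enn2real (subslope u x)" for x
  have lip: "u \<in> Lip_loc \<Omega>" and root: "\<And>x. x \<in> \<Omega> \<Longrightarrow> H x (u x) (p x) = 0"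
    using assms(6) by (auto simp: monge_solution_def p_def)
  have contu: "continuous_on \<Omega> u" using lip by (rule Lip_loc_continuous_on)
  \<comment> \<open>The local Lipschitz constant excludes an infinite subslope, which
    \<open>enn2real\<close> would send to 0.\<close>
  have sub: "subslope u x = ennreal (p x)" if x: "x \<in> \<Omega>" for x
  proof -
    obtain r L where "r > 0" "L-lipschitz_on (ball x r) u" using lip x by (auto simp: Lip_loc_def)
    then have "subslope u x \<le> ennreal L"
      using slope_le_lipschitz subslope_le_slope order_trans by blast
    also have "\<dots> < \<infinity>" by simp
    finally show ?thesis by (simp add: p_def)
  qed
  \<comment> \<open>The source type is left general: below, \<open>T\<close> is \<Omega> with the
    last argument fixed, or the half-line of the last argument with the point fixed.\<close>
  have contH: "continuous_on T (\<lambda>z. H (f z) (g z) (h z))"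
    if "continuous_on T f" "continuous_on T g" "continuous_on T h"
      "f ` T \<subseteq> \<Omega>" "h ` T \<subseteq> {0..}" for T :: "'b::topological_space set" and f g h
  proof -
    have "continuous_on T (\<lambda>z. (f z, g z, h z))" using that by (intro continuous_intros)
    moreover have "(\<lambda>z. (f z, g z, h z)) ` T \<subseteq> \<Omega> \<times> UNIV \<times> {0..}" using that by auto
    ultimately show ?thesis using continuous_on_compose2[OF assms(3)] by force
  qed
  have mono: "strict_mono_on {0..} (H x (u x))" if x: "x \<in> \<Omega>" for x
    using assms(5)
  proof
    assume "locally_uniformly_continuous \<Omega> H \<and> locally_strongly_increasing \<Omega> H"
    then obtain \<delta> \<kappa> where "\<delta> > 0" "\<kappa> > 0" and
      *: "\<forall>y\<in>ball x \<delta>. \<forall>\<rho>\<in>{u x - \<delta>..u x + \<delta>}. mono_on {0..} (\<lambda>p. H y \<rho> p - \<kappa> * p)"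
      using x unfolding locally_strongly_increasing_def by meson
    then have "mono_on {0..} (\<lambda>p. H x (u x) p - \<kappa> * p)" by simp
    show ?thesis
    proof (rule strict_mono_onI)
      fix q q' :: real assume q: "q \<in> {0..}" "q' \<in> {0..}" "q < q'"
      then have "H x (u x) q - \<kappa> * q \<le> H x (u x) q' - \<kappa> * q'"
        using monotone_onD[OF \<open>mono_on _ _\<close>, of q q'] by simp
      \<comment> \<open>The linear term turns the weak monotonicity into a strict one.\<close>
      moreover have "\<kappa> * q < \<kappa> * q'" using q \<open>\<kappa> > 0\<close> by simp
      ultimately show "H x (u x) q < H x (u x) q'" by linarith
    qed
  next
    assume "proper_space TYPE('a) \<and> geodesic_space TYPE('a) \<and>
          (\<forall>x\<in>\<Omega>. \<forall>\<rho>. strict_mono_on {0<..} (\<lambda>p. H x \<rho> p))"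
    then show ?thesis
      using x by (intro strict_mono_on_atLeast_if_greaterThan contH) (auto intro!: continuous_intros)
  qed
  have contp: "continuous_on \<Omega> p"
  proof (rule continuous_on_root[where F = "\<lambda>x. H x (u x)"])
    show "continuous_on \<Omega> (\<lambda>x. H x (u x) q)" if "0 \<le> q" for q
      using that by (intro contH continuous_on_id continuous_on_const contu) auto
  qed (use root mono in \<open>simp_all add: p_def\<close>)
  have slope_eq: "slope u x = subslope u x" if x: "x \<in> \<Omega>" for x
  proof (rule antisym[OF _ subslope_le_slope])
    have "slope u x \<le> ennreal K" if K: "p x < K" for K
    proof -
      \<comment> \<open>Continuity of \<open>p\<close> spreads the bound at \<open>x\<close> to a
        whole ball, as the Lipschitz estimate requires.\<close>
      have "open {y \<in> \<Omega>. p y < K}"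
        using continuous_open_preimage[OF contp assms(2), of "{..<K}"]
        by (simp add: vimage_def Int_def)
      then obtain r where r: "r > 0" "ball x r \<subseteq> {y \<in> \<Omega>. p y < K}"
        using x K by (force simp: open_contains_ball)
      have "K-lipschitz_on (ball x (r / 3)) u"
      proof (rule lipschitz_on_if_subslope_less[OF assms(1)])
        show "continuous_on (ball x r) u" using r(2) by (intro continuous_on_subset[OF contu]) auto
        show "0 \<le> K" using K enn2real_nonneg[of "subslope u x"] unfolding p_def by linarith
        show "subslope u y < ennreal K" if "y \<in> ball x r" for y
        proof -
          have "y \<in> \<Omega>" "p y < K" using that r(2) by auto
          moreover have "0 \<le> p y" by (simp add: p_def)
          ultimately show ?thesis using sub[of y] by (simp add: ennreal_less_iff)
        qed
      qed
      then show ?thesis using r(1) by (intro slope_le_lipschitz[of "r / 3"]) auto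
    qed
    then have "\<forall>\<^sub>F K in at_right (p x). slope u x \<le> ennreal K"
      by (auto simp: eventually_at_filter)
    moreover have "(ennreal \<longlongrightarrow> ennreal (p x)) (at_right (p x))"
      by (intro tendsto_ennrealI tendsto_ident_at)
    ultimately have "slope u x \<le> ennreal (p x)"
      by (intro tendsto_lowerbound) auto
    then show "slope u x \<le> subslope u x" using sub x by simp
  qed
  \<comment> \<open>On \<Omega> the slope is now the continuous root \<open>p\<close>, read in
    \<open>ennreal\<close>.\<close>
  have "continuous_on \<Omega> (slope u)"
    using continuous_on_cong[of \<Omega> \<Omega> "slope u" "\<lambda>x. ennreal (p x)"] continuous_on_ennreal[OF contp]
      slope_eq sub by simp
  then show ?thesis
    using lip slope_eq by (simp add: regular_on_def C_lower_def)
qed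

end
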